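(* Let $R$ be a reduced ring of characteristic $p>0$ that is a quotient of an $F$-finite regular ring, let $\mathfrak a\subseteq R$ be an ideal such that $\mathfrak a\cap R^\circ\neq\emptyset$, and let $t>0$ be a real number such that $(R,\mathfrak a^t)$ is sharply $F$-pure. Then $R/\tau_R(\mathfrak a^t)$ is $F$-pure.
   Context: Rings are commutative with unit, Noetherian, excellent and contain a field of characteristic $p>0$. $R^\circ$ is the set of elements of $R$ not contained in any minimal prime of $R$. $I^{[p^e]}$ is the ideal generated by the $p^e$-th powers of elements of the ideal $I$. Convention: $\mathfrak a^0=R$. $\mathfrak a^t$-tight closure: $I^{*\mathfrak a^t}$ is the set of $z\in R$ for which there exists $c\in R^\circ$ with $c\,\mathfrak a^{\lceil tp^e\rceil}z^{p^e}\subseteq I^{[p^e]}$ for all $e\gg0$. Generalized test ideal: $\tau_R(\mathfrak a^t)=\bigcap_{J\subseteq R}(J:J^{*\mathfrak a^t})$, $J$ running over all ideals of $R$. $R^{1/p^e}$ is the ring of $p^e$-th roots of elements of the reduced ring $R$, regarded as an $R$-module via $F^e:R\subseteq R^{1/p^e}$. For $f\in R$, $f^{1/p^e}F^e:R\to R^{1/p^e}$ is the $R$-linear map sending $1$ to $f^{1/p^e}$; it splits if it has an $R$-linear left inverse. $(R,\mathfrak a^t)$ is sharply $F$-pure if there exist infinitely many integers $e\ge0$ and associated elements $f_e\in\mathfrak a^{\lceil t(p^e-1)\rceil}$ such that each map $f_e^{1/p^e}F^e:R\to R^{1/p^e}$ splits. An $F$-finite ring $A$ is $F$-pure if its Frobenius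 map $A\to A$, with the target viewed as an $A$-module via Frobenius, splits as a map of $A$-modules (the zero ring is trivially $F$-pure). *)

theory Defs
  imports Complex_Main "HOL-Algebra.Algebra" "HOL-Library.Extended_Nat"
begin

section \<open>Rings of prime characteristic\<close>

definition char_p_ring :: "nat \<Rightarrow> ('a, 'm) ring_scheme \<Rightarrow> bool" where
  "char_p_ring p R \<longleftrightarrow> cring R \<and> Factorial_Ring.prime p \<and>
     (\<exists>K. subfield K R \<and> add_pow R p \<one>\<^bsub>R\<^esub> = \<zero>\<^bsub>R\<^esub>)"

definition reduced_ring :: "('a, 'm) ring_scheme \<Rightarrow> bool" where
  "reduced_ring R \<longleftrightarrow>
     cring R \<and> (\<forall>x\<in>carrier R. \<forall>n::nat. x [^]\<^bsub>R\<^esub> n = \<zero>\<^bsub>R\<^esub> \<longrightarrow> x = \<zero>\<^bsub>R\<^esub>)"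

definition minimal_prime :: "'a set \<Rightarrow> ('a, 'm) ring_scheme \<Rightarrow> bool" where
  "minimal_prime P R \<longleftrightarrow> primeideal P R \<and> (\<forall>Q. primeideal Q R \<and> Q \<subseteq> P \<longrightarrow> Q = P)"

definition not_in_minimal_primes :: "('a, 'm) ring_scheme \<Rightarrow> 'a set" where
  "not_in_minimal_primes R = {c \<in> carrier R. \<forall>P. minimal_prime P R \<longrightarrow> c \<notin> P}"


section \<open>Modules, roots and splittings\<close>

definition module_hom ::
    "('a, 'm) ring_scheme \<Rightarrow> ('a, 'b, 'k) module_scheme \<Rightarrow> ('a, 'c, 'l) module_scheme \<Rightarrow> ('b \<Rightarrow> 'c) set"
  where "module_hom R M N = {h \<in> carrier M \<rightarrow> carrier N.
     (\<forall>x\<in>carrier M. \<forall>y\<in>carrier M. h (x \<oplus>\<^bsub>M\<^esub> y) = h x \<oplus>\<^bsub>N\<^esub> h y) \<and>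
     (\<forall>r\<in>carrier R. \<forall>x\<in>carrier M. h (r \<odot>\<^bsub>M\<^esub> x) = r \<odot>\<^bsub>N\<^esub> h x)}"

definition splits ::
    "('a, 'm) ring_scheme \<Rightarrow> ('a, 'b, 'k) module_scheme \<Rightarrow> ('a, 'c, 'l) module_scheme \<Rightarrow> ('b \<Rightarrow> 'c) \<Rightarrow> bool"
  where "splits R M N f \<longleftrightarrow> (\<exists>g \<in> module_hom R N M. \<forall>x\<in>carrier M. g (f x) = x)"

definition finitely_generated_module ::
    "('a, 'm) ring_scheme \<Rightarrow> ('a, 'b, 'k) module_scheme \<Rightarrow> bool" where
  "finitely_generated_module R M \<longleftrightarrow> (\<exists>G. finite G \<and> G \<subseteq> carrier M \<and>
     (\<forall>x\<in>carrier M. \<exists>a \<in> G \<rightarrow> carrier R. x = (\<Oplus>\<^bsub>M\<^esub>g\<in>G. a g \<odot>\<^bsub>M\<^esub> g)))"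

definition self_module :: "('a, 'm) ring_scheme \<Rightarrow> ('a, 'a) module" where
  "self_module R = \<lparr>carrier = carrier R, monoid.mult = monoid.mult R, one = one R, ring.zero = ring.zero R,
     ring.add = ring.add R, smult = monoid.mult R\<rparr>"

definition frobenius_algebra :: "nat \<Rightarrow> ('a, 'm) ring_scheme \<Rightarrow> nat \<Rightarrow> ('a, 'a) module" where
  "frobenius_algebra p R e = \<lparr>carrier = carrier R, monoid.mult = monoid.mult R, one = one R, ring.zero = ring.zero R,
     ring.add = ring.add R, smult = (\<lambda>r x. r [^]\<^bsub>R\<^esub> (p ^ e) \<otimes>\<^bsub>R\<^esub> x)\<rparr>"

text \<open>
  The ring \<open>R\<^sup>1\<^sup>/\<^sup>q\<close>, \<open>q = p ^ e\<close>, of \<open>q\<close>-th roots of elements of a reduced ring \<open>R\<close>, as an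
  \<open>R\<close>-algebra. The root of \<open>x\<close> is represented by \<open>x\<close> itself; this determines the operations,
  since taking \<open>q\<close>-th roots is additive and multiplicative, and the element \<open>r\<close> of the subring
  \<open>R\<close> of \<open>R\<^sup>1\<^sup>/\<^sup>q\<close> is the root of \<open>r\<^sup>q\<close>. The lemmas below check that this is an \<open>R\<close>-algebra whose
  structure map is injective for reduced \<open>R\<close>, and that \<open>x\<close>, as an element of \<open>R\<^sup>1\<^sup>/\<^sup>q\<close>, is a
  \<open>q\<close>-th root of (the image of) \<open>x \<in> R\<close>.
\<close>

abbreviation root_ring :: "nat \<Rightarrow> ('a, 'm) ring_scheme \<Rightarrow> nat \<Rightarrow> ('a, 'a) module" where
  "root_ring \<equiv> frobenius_algebra"

text \<open>The element \<open>f\<close> below represents its \<open>q\<close>-th root in \<open>R\<^sup>1\<^sup>/\<^sup>q\<close>, so \<open>1\<close> is sent to that root.\<close>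

definition root_map :: "nat \<Rightarrow> ('a, 'm) ring_scheme \<Rightarrow> nat \<Rightarrow> 'a \<Rightarrow> 'a \<Rightarrow> 'a" where
  "root_map p R e f = (\<lambda>r. r \<odot>\<^bsub>root_ring p R e\<^esub> f)"

lemma (in cring) add_power_binomial:
  assumes x: "x \<in> carrier R" and y: "y \<in> carrier R"
  shows "(x \<oplus> y) [^] n = (\<Oplus>i\<in>{..n}. add_pow R (n choose i) (x [^] i \<otimes> y [^] (n - i)))"
proof (induction n)
  case 0
  show ?case using x y by simp
next
  case (Suc n)
  define T where "T k i = add_pow R (n choose k) (x [^] i \<otimes> y [^] (Suc n - i))" for k i :: nat
  have T: "T k i \<in> carrier R" for k i
    unfolding T_def using x y by simp
  let ?S = "(\<Oplus>i\<in>{..n}. add_pow R (n choose i) (x [^] i \<otimes> y [^] (n - i)))"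
  have xS: "x \<otimes> ?S = (\<Oplus>i\<in>{..n}. T i (Suc i))"
    unfolding T_def using x y
    by (subst finsum_rdistr) (auto intro!: finsum_cong' simp: add_pow_rdistr m_ac nat_pow_Suc)
  have yS: "y \<otimes> ?S = (\<Oplus>i\<in>{..n}. T i i)"
    unfolding T_def using x y
    by (subst finsum_rdistr)
      (auto intro!: finsum_cong' simp: add_pow_rdistr m_ac nat_pow_Suc Suc_diff_le)
  have "(\<Oplus>i\<in>{..n}. T i i) = (\<Oplus>i\<in>{..Suc n}. T i i)"
    using T x y by (simp add: finsum_Suc) (simp add: T_def binomial_eq_0 add.nat_pow_0)
  also have "\<dots> = (\<Oplus>i\<in>{..n}. T (Suc i) (Suc i)) \<oplus> T 0 0"
    using T by (subst finsum_Suc2) auto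
  finally have yS': "y \<otimes> ?S = (\<Oplus>i\<in>{..n}. T (Suc i) (Suc i)) \<oplus> T 0 0"
    using yS by simp
  have "(x \<oplus> y) [^] Suc n = (x \<oplus> y) \<otimes> ?S"
    using x y by (simp add: Suc.IH nat_pow_Suc m_comm)
  also have "\<dots> = x \<otimes> ?S \<oplus> y \<otimes> ?S"
    using x y by (intro l_distr) auto
  also have "\<dots> = ((\<Oplus>i\<in>{..n}. T i (Suc i)) \<oplus> (\<Oplus>i\<in>{..n}. T (Suc i) (Suc i))) \<oplus> T 0 0"
    using T by (simp add: xS yS' a_assoc)
  also have "(\<Oplus>i\<in>{..n}. T i (Suc i)) \<oplus> (\<Oplus>i\<in>{..n}. T (Suc i) (Suc i)) =
      (\<Oplus>i\<in>{..n}. T i (Suc i) \<oplus> T (Suc i) (Suc i))"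
    using T by (intro finsum_addf[symmetric]) auto
  also have "\<dots> = (\<Oplus>i\<in>{..n}. add_pow R (Suc n choose Suc i) (x [^] Suc i \<otimes> y [^] (Suc n - Suc i)))"
    unfolding T_def using x y by (intro finsum_cong') (auto simp: add.nat_pow_mult)
  also have "\<dots> \<oplus> T 0 0 = (\<Oplus>i\<in>{..Suc n}. add_pow R (Suc n choose i) (x [^] i \<otimes> y [^] (Suc n - i)))"
    unfolding T_def using x y by (subst finsum_Suc2) auto
  finally show ?case .
qed

lemma char_p_ring_multiple_zero:
  fixes R (structure)
  assumes "char_p_ring p R" "p dvd k" "x \<in> carrier R"
  shows "add_pow R k x = \<zero>"
proof -
  interpret cring R using assms(1) by (simp add: char_p_ring_def)
  obtain m where m: "k = p * m" using assms(2) by blast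
  have "add_pow R p \<one> = \<zero>" using assms(1) by (simp add: char_p_ring_def)
  then have "add_pow R k \<one> = \<zero>"
    unfolding m using add.nat_pow_pow[of \<one> m p] by simp
  then show ?thesis
    using add_pow_ldistr[of \<one> x k] assms(3) by simp
qed

lemma char_p_ring_add_pow:
  fixes R (structure)
  assumes R: "char_p_ring p R" and x: "x \<in> carrier R" and y: "y \<in> carrier R"
  shows "(x \<oplus> y) [^] (p ^ e) = x [^] (p ^ e) \<oplus> y [^] (p ^ e)"
proof -
  interpret cring R using R by (simp add: char_p_ring_def)
  have p: "Factorial_Ring.prime p" using R by (simp add: char_p_ring_def)
  have base: "(a \<oplus> b) [^] p = a [^] p \<oplus> b [^] p"
    if a: "a \<in> carrier R" and b: "b \<in> carrier R" for a b
  proof -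
    obtain q where q: "p = Suc (Suc q)"
      using prime_ge_2_nat[OF p] by (metis add_2_eq_Suc le_Suc_ex)
    define T where "T i = add_pow R (p choose i) (a [^] i \<otimes> b [^] (p - i))" for i
    have T: "T i \<in> carrier R" for i
      unfolding T_def using a b by simp
    have zero: "T (Suc i) = \<zero>" if "i \<le> q" for i
      unfolding T_def using a b that q
      by (intro char_p_ring_multiple_zero[OF R] dvd_choose_prime p) auto
    have "(a \<oplus> b) [^] p = (\<Oplus>i\<in>{..Suc (Suc q)}. T i)"
      unfolding T_def q[symmetric] by (rule add_power_binomial[OF a b])
    also have "\<dots> = T (Suc (Suc q)) \<oplus> ((\<Oplus>i\<in>{..q}. T (Suc i)) \<oplus> T 0)"
      using T by (subst finsum_Suc, simp, subst finsum_Suc2) auto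
    also have "(\<Oplus>i\<in>{..q}. T (Suc i)) = \<zero>"
      using zero by (intro add.finprod_one_eqI) auto
    also have "T (Suc (Suc q)) = a [^] p"
      using a b unfolding T_def q by simp
    also have "T 0 = b [^] p"
      using a b unfolding T_def q by simp
    finally show ?thesis using a b by simp
  qed
  show ?thesis
  proof (induction e)
    case 0
    show ?case using x y by simp
  next
    case (Suc e)
    have "(x \<oplus> y) [^] (p ^ Suc e) = ((x \<oplus> y) [^] (p ^ e)) [^] p"
      using x y by (simp add: nat_pow_pow mult.commute)
    also have "\<dots> = (x [^] (p ^ e)) [^] p \<oplus> (y [^] (p ^ e)) [^] p"
      using x y by (simp add: Suc.IH base)
    finally show ?case using x y by (simp add: nat_pow_pow mult.commute)
  qed
qed

lemma root_ring_algebra: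
  fixes R (structure)
  assumes "char_p_ring p R"
  shows "algebra R (root_ring p R e)"
proof -
  interpret cring R using assms by (simp add: char_p_ring_def)
  show ?thesis
  proof (rule algebraI)
    have inv: "\<exists>y\<in>carrier R. y \<oplus> x = \<zero>" if "x \<in> carrier R" for x
      using that by (intro bexI[of _ "\<ominus> x"]) (auto simp: l_neg)
    show "cring (root_ring p R e)"
      unfolding frobenius_algebra_def
      by (intro cringI abelian_groupI comm_monoidI)
        (use inv in \<open>simp_all add: m_ac a_ac l_distr r_distr\<close>)
    show "cring R" by (rule is_cring)
  qed (simp_all add: frobenius_algebra_def nat_pow_distrib m_assoc l_distr r_distr
      char_p_ring_add_pow[OF assms])
qed

lemma root_ring_root:
  assumes "cring R" "x \<in> carrier R"
  shows "x [^]\<^bsub>root_ring p R e\<^esub> (p ^ e) = x \<odot>\<^bsub>root_ring p R e\<^esub> \<one>\<^bsub>root_ring p R e\<^esub>"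
proof -
  interpret cring R by fact
  have "x [^]\<^bsub>root_ring p R e\<^esub> n = x [^]\<^bsub>R\<^esub> n" for n :: nat
    by (simp add: nat_pow_def frobenius_algebra_def)
  then show ?thesis
    using assms(2) by (simp add: frobenius_algebra_def)
qed

lemma root_ring_inj:
  assumes "char_p_ring p R" "reduced_ring R"
  shows "inj_on (\<lambda>r. r \<odot>\<^bsub>root_ring p R e\<^esub> \<one>\<^bsub>root_ring p R e\<^esub>) (carrier R)"
proof (rule inj_onI)
  interpret cring R using assms(1) by (simp add: char_p_ring_def)
  fix x y assume x: "x \<in> carrier R" and y: "y \<in> carrier R"
    and "x \<odot>\<^bsub>root_ring p R e\<^esub> \<one>\<^bsub>root_ring p R e\<^esub> = y \<odot>\<^bsub>root_ring p R e\<^esub> \<one>\<^bsub>root_ring p R e\<^esub>"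
  then have eq: "x [^]\<^bsub>R\<^esub> (p ^ e) = y [^]\<^bsub>R\<^esub> (p ^ e)"
    by (simp add: frobenius_algebra_def)
  define d where "d = x \<ominus>\<^bsub>R\<^esub> y"
  have d: "d \<in> carrier R" "x = d \<oplus>\<^bsub>R\<^esub> y"
    using x y by (auto simp: d_def minus_eq a_assoc l_neg)
  then have "d [^]\<^bsub>R\<^esub> (p ^ e) \<oplus>\<^bsub>R\<^esub> y [^]\<^bsub>R\<^esub> (p ^ e) = y [^]\<^bsub>R\<^esub> (p ^ e)"
    using eq y char_p_ring_add_pow[OF assms(1)] by metis
  then have "d [^]\<^bsub>R\<^esub> (p ^ e) = \<zero>\<^bsub>R\<^esub>"
    using d y by simp
  then have "d = \<zero>\<^bsub>R\<^esub>"
    using assms(2) d unfolding reduced_ring_def by blast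
  then show "x = y" using d y by simp
qed


section \<open>Regular rings\<close>

text \<open>Fractions with denominators in a multiplicative set \<open>D\<close>, as equivalence classes of pairs.\<close>

definition fraction_rel :: "('a, 'm) ring_scheme \<Rightarrow> 'a set \<Rightarrow> (('a \<times> 'a) \<times> ('a \<times> 'a)) set" where
  "fraction_rel R D = {((a, s), (b, u)). a \<in> carrier R \<and> b \<in> carrier R \<and> s \<in> D \<and> u \<in> D \<and>
     (\<exists>v\<in>D. v \<otimes>\<^bsub>R\<^esub> (a \<otimes>\<^bsub>R\<^esub> u) = v \<otimes>\<^bsub>R\<^esub> (b \<otimes>\<^bsub>R\<^esub> s))}"

definition localization :: "('a, 'm) ring_scheme \<Rightarrow> 'a set \<Rightarrow> ('a \<times> 'a) set ring" where
  "localization R D =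
     \<lparr>carrier = (carrier R \<times> D) // fraction_rel R D,
      monoid.mult = (\<lambda>A B. \<Union>x\<in>A. \<Union>y\<in>B.
        fraction_rel R D `` {(fst x \<otimes>\<^bsub>R\<^esub> fst y, snd x \<otimes>\<^bsub>R\<^esub> snd y)}),
      one = fraction_rel R D `` {(\<one>\<^bsub>R\<^esub>, \<one>\<^bsub>R\<^esub>)},
      ring.zero = fraction_rel R D `` {(\<zero>\<^bsub>R\<^esub>, \<one>\<^bsub>R\<^esub>)},
      ring.add = (\<lambda>A B. \<Union>x\<in>A. \<Union>y\<in>B.
        fraction_rel R D ``
          {(fst x \<otimes>\<^bsub>R\<^esub> snd y \<oplus>\<^bsub>R\<^esub> fst y \<otimes>\<^bsub>R\<^esub> snd x, snd x \<otimes>\<^bsub>R\<^esub> snd y)})\<rparr>"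

definition krull_dim :: "('a, 'm) ring_scheme \<Rightarrow> enat" where
  "krull_dim R = Sup {enat n | n. \<exists>P. (\<forall>i\<le>n. primeideal (P i) R) \<and> (\<forall>i<n. P i \<subset> P (Suc i))}"

definition min_generators :: "('a, 'm) ring_scheme \<Rightarrow> 'a set \<Rightarrow> nat" where
  "min_generators R I = (LEAST n. \<exists>G. finite G \<and> card G = n \<and> G \<subseteq> carrier R \<and> Idl\<^bsub>R\<^esub> G = I)"

definition regular_local_ring :: "('a, 'm) ring_scheme \<Rightarrow> bool" where
  "regular_local_ring R \<longleftrightarrow> cring R \<and> noetherian_ring R \<and>
     (\<exists>M. {N. maximalideal N R} = {M} \<and> krull_dim R = enat (min_generators R M))"

definition regular_ring :: "('a, 'm) ring_scheme \<Rightarrow> bool" where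
  "regular_ring R \<longleftrightarrow> cring R \<and> noetherian_ring R \<and>
     (\<forall>P. primeideal P R \<longrightarrow> regular_local_ring (localization R (carrier R - P)))"


section \<open>F-finite and F-pure rings\<close>

text \<open>
  Noetherian F-finite rings are excellent (Kunz), and F-finiteness passes to quotients. So excellence
  needs no separate hypothesis for a quotient of an F-finite regular ring.
\<close>

definition F_finite :: "nat \<Rightarrow> ('a, 'm) ring_scheme \<Rightarrow> bool" where
  "F_finite p A \<longleftrightarrow> finitely_generated_module A (frobenius_algebra p A 1)"

definition F_pure :: "nat \<Rightarrow> ('a, 'm) ring_scheme \<Rightarrow> bool" where
  "F_pure p A \<longleftrightarrow> splits A (self_module A) (frobenius_algebra p A 1) (\<lambda>x. x [^]\<^bsub>A\<^esub> p)"

text \<open>The power \<open>\<aa>\<^sup>n\<close> of an ideal is taken in the semiring of ideals, so that \<open>\<aa>\<^sup>0 = R\<close>.\<close>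

definition sharply_F_pure :: "nat \<Rightarrow> ('a, 'm) ring_scheme \<Rightarrow> 'a set \<Rightarrow> real \<Rightarrow> bool" where
  "sharply_F_pure p R \<aa> t \<longleftrightarrow> infinite {e::nat.
     \<exists>f \<in> \<aa> [^]\<^bsub>ideals_set R\<^esub> nat \<lceil>t * (real p ^ e - 1)\<rceil>.
       splits R (self_module R) (root_ring p R e) (root_map p R e f)}"


section \<open>Tight closure and test ideals\<close>

definition frobenius_power :: "nat \<Rightarrow> ('a, 'm) ring_scheme \<Rightarrow> 'a set \<Rightarrow> nat \<Rightarrow> 'a set" where
  "frobenius_power p R I e = Idl\<^bsub>R\<^esub> ((\<lambda>x. x [^]\<^bsub>R\<^esub> (p ^ e)) ` I)"

definition tight_closure :: "nat \<Rightarrow> ('a, 'm) ring_scheme \<Rightarrow> 'a set \<Rightarrow> real \<Rightarrow> 'a set \<Rightarrow> 'a set" where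
  "tight_closure p R \<aa> t I = {z \<in> carrier R. \<exists>c \<in> not_in_minimal_primes R. \<exists>e\<^sub>0::nat. \<forall>e\<ge>e\<^sub>0.
     \<forall>a \<in> \<aa> [^]\<^bsub>ideals_set R\<^esub> nat \<lceil>t * real p ^ e\<rceil>.
       c \<otimes>\<^bsub>R\<^esub> a \<otimes>\<^bsub>R\<^esub> z [^]\<^bsub>R\<^esub> (p ^ e) \<in> frobenius_power p R I e}"

definition colon :: "('a, 'm) ring_scheme \<Rightarrow> 'a set \<Rightarrow> 'a set \<Rightarrow> 'a set" where
  "colon R I J = {x \<in> carrier R. \<forall>y\<in>J. x \<otimes>\<^bsub>R\<^esub> y \<in> I}"

definition test_ideal :: "nat \<Rightarrow> ('a, 'm) ring_scheme \<Rightarrow> 'a set \<Rightarrow> real \<Rightarrow> 'a set" where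
  "test_ideal p R \<aa> t = (\<Inter>J\<in>{J. ideal J R}. colon R J (tight_closure p R \<aa> t J))"

end

theory Submission
  imports Defs
begin

text \<open>
  Fix \<open>e \<ge> 1\<close>, \<open>q = p\<^sup>e\<close>, an element \<open>f\<close> of the ideal power with exponent \<open>\<lceil>t(q - 1)\<rceil>\<close> and an
  \<open>R\<close>-linear left inverse \<open>\<phi>\<close> of \<open>f\<^sup>1\<^sup>/\<^sup>qF\<^sup>e\<close>. Regard \<open>\<phi>\<close> as an additive map \<open>R \<rightarrow> R\<close> with
  \<open>\<phi>(r\<^sup>qx) = r\<phi>(x)\<close> and \<open>\<phi>(f) = 1\<close>, and write \<open>\<tau>\<close> for the test ideal. The argument, in the style of
  Vassilev, is that \<open>\<psi>(x) = \<phi>(xf)\<close> maps \<open>\<tau>\<close> into itself, so that it induces a splitting of the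
  \<open>e\<close>-th Frobenius of \<open>R/\<tau>\<close>.

  The key point (\<open>mult_power_in_tight_closure\<close>) is that if \<open>z\<close> lies in the tight closure \<open>J\<^sup>*\<close> of
  an ideal \<open>J\<close>, then \<open>fz\<^sup>q\<close> lies in the tight closure of \<open>J\<^sup>[\<^sup>q\<^sup>]\<close>; this rests on the inequality
  \<open>\<lceil>tqP\<rceil> \<le> \<lceil>tP\<rceil> + P\<lceil>t(q - 1)\<rceil>\<close> for the exponents, \<open>P\<close> being a
  further power of \<open>p\<close>. For \<open>x \<in> \<tau>\<close> it follows that
  \<open>xfz\<^sup>q \<in> J\<^sup>[\<^sup>q\<^sup>]\<close>, and hence \<open>\<psi>(x)z = \<phi>(xfz\<^sup>q) \<in> \<phi>(J\<^sup>[\<^sup>q\<^sup>]) \<subseteq> J\<close>. As \<open>J\<close> and \<open>z\<close> are arbitrary,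
  \<open>\<psi>(x) \<in> \<tau>\<close>.

  Finally, composing with the Frobenius power \<open>x \<mapsto> x\<^bsup>q/p\<^esup>\<close> turns \<open>\<psi>\<close> into a map that splits the
  Frobenius itself and still preserves \<open>\<tau>\<close>.
\<close>

text \<open>
  Written out on \<open>R\<close>, an \<open>R\<close>-linear map \<open>R\<^sup>1\<^sup>/\<^sup>q \<rightarrow> R\<close> is an additive map that takes \<open>q\<close>-th powers out as
  their roots.
\<close>

lemma module_hom_root_ring_iff:
  "\<phi> \<in> module_hom R (root_ring p R e) (self_module R) \<longleftrightarrow>
     \<phi> \<in> carrier R \<rightarrow> carrier R \<and>
     (\<forall>x\<in>carrier R. \<forall>y\<in>carrier R. \<phi> (x \<oplus>\<^bsub>R\<^esub> y) = \<phi> x \<oplus>\<^bsub>R\<^esub> \<phi> y) \<and>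
     (\<forall>r\<in>carrier R. \<forall>x\<in>carrier R. \<phi> (r [^]\<^bsub>R\<^esub> (p ^ e) \<otimes>\<^bsub>R\<^esub> x) = r \<otimes>\<^bsub>R\<^esub> \<phi> x)"
  by (simp add: module_hom_def frobenius_algebra_def self_module_def)


context cring
begin

section \<open>Powers and Frobenius powers of ideals\<close>

lemma ideal_pow_ideal:
  assumes "ideal I R"
  shows "ideal (I [^]\<^bsub>ideals_set R\<^esub> (n::nat)) R"
proof -
  interpret IS: semiring "ideals_set R" by (rule ideals_set_is_semiring)
  have "I \<in> carrier (ideals_set R)" using assms by (simp add: ideals_set_def)
  then have "I [^]\<^bsub>ideals_set R\<^esub> n \<in> carrier (ideals_set R)" by (rule IS.nat_pow_closed)
  then show ?thesis by (simp add: ideals_set_def)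
qed

lemma ideal_pow_add:
  assumes "ideal I R"
  shows "I [^]\<^bsub>ideals_set R\<^esub> (m + n) =
    (I [^]\<^bsub>ideals_set R\<^esub> m) \<cdot> (I [^]\<^bsub>ideals_set R\<^esub> (n::nat))"
proof -
  interpret IS: semiring "ideals_set R" by (rule ideals_set_is_semiring)
  have "I \<in> carrier (ideals_set R)" using assms by (simp add: ideals_set_def)
  from IS.nat_pow_mult[OF this, of m n] show ?thesis by (simp add: ideals_set_def)
qed

lemma ideal_pow_mult_closed:
  assumes "ideal I R" "a \<in> I [^]\<^bsub>ideals_set R\<^esub> (m::nat)" "b \<in> I [^]\<^bsub>ideals_set R\<^esub> (n::nat)"
  shows "a \<otimes> b \<in> I [^]\<^bsub>ideals_set R\<^esub> (m + n)"
  using ideal_prod.prod[OF assms(2,3)] ideal_pow_add[OF assms(1)] by simp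

lemma ideal_pow_antimono:
  assumes "ideal I R" "n \<le> m"
  shows "I [^]\<^bsub>ideals_set R\<^esub> m \<subseteq> I [^]\<^bsub>ideals_set R\<^esub> (n::nat)"
  using ideal_prod_inter[OF ideal_pow_ideal[OF assms(1)] ideal_pow_ideal[OF assms(1)], of n "m - n"]
    ideal_pow_add[OF assms(1), of n "m - n"] assms(2) by simp

lemma power_in_ideal_pow:
  assumes "ideal I R" "a \<in> I [^]\<^bsub>ideals_set R\<^esub> (n::nat)"
  shows "a [^] k \<in> I [^]\<^bsub>ideals_set R\<^esub> (k * n)"
proof (induction k)
  case 0
  show ?case by (simp add: ideals_set_def)
next
  case (Suc k)
  from ideal_pow_mult_closed[OF assms(1) Suc assms(2)] show ?case by (simp add: add.commute)
qed

lemma frobenius_power_ideal: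
  assumes "ideal J R"
  shows "ideal (frobenius_power p R J e) R"
  unfolding frobenius_power_def
  using ideal.Icarr[OF assms] by (intro genideal_ideal) auto

lemma power_in_frobenius_power:
  assumes "ideal J R" "x \<in> J"
  shows "x [^] (p ^ e) \<in> frobenius_power p R J e"
proof -
  have "(\<lambda>x. x [^] (p ^ e)) ` J \<subseteq> carrier R" using ideal.Icarr[OF assms(1)] by auto
  from genideal_self[OF this] show ?thesis using assms(2) by (auto simp: frobenius_power_def)
qed

lemma frobenius_power_add_subset:
  assumes "ideal J R"
  shows "frobenius_power p R J (e + d) \<subseteq> frobenius_power p R (frobenius_power p R J e) d"
proof -
  let ?K = "frobenius_power p R (frobenius_power p R J e) d"
  have I: "ideal (frobenius_power p R J e) R" by (rule frobenius_power_ideal[OF assms])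
  have "x [^] (p ^ (e + d)) \<in> ?K" if "x \<in> J" for x
    using power_in_frobenius_power[OF I power_in_frobenius_power[OF assms that]]
      ideal.Icarr[OF assms that] by (simp add: nat_pow_pow power_add)
  then show ?thesis
    unfolding frobenius_power_def[of p R J "e + d"]
    by (intro genideal_minimal frobenius_power_ideal I) auto
qed

text \<open>An \<open>R\<close>-linear map \<open>R\<^sup>1\<^sup>/\<^sup>q \<rightarrow> R\<close> sends \<open>J\<^sup>[\<^sup>q\<^sup>]\<close>, which represents \<open>JR\<^sup>1\<^sup>/\<^sup>q\<close>, into \<open>J\<close>.\<close>

lemma module_hom_frobenius_power:
  assumes "\<phi> \<in> module_hom R (root_ring p R e) (self_module R)" "ideal J R"
    and "y \<in> frobenius_power p R J e"
  shows "\<phi> y \<in> J"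
proof -
  interpret J: ideal J R by fact
  have \<phi>: "\<And>x. x \<in> carrier R \<Longrightarrow> \<phi> x \<in> carrier R"
    "\<And>x y. x \<in> carrier R \<Longrightarrow> y \<in> carrier R \<Longrightarrow> \<phi> (x \<oplus> y) = \<phi> x \<oplus> \<phi> y"
    "\<And>r x. r \<in> carrier R \<Longrightarrow> x \<in> carrier R \<Longrightarrow> \<phi> (r [^] (p ^ e) \<otimes> x) = r \<otimes> \<phi> x"
    using assms(1) unfolding module_hom_root_ring_iff by auto
  \<comment> \<open>The largest ideal of \<open>R\<close> contained in the preimage of \<open>J\<close>, which need not be an ideal itself.\<close>
  define K where "K = {y \<in> carrier R. \<forall>s\<in>carrier R. \<phi> (s \<otimes> y) \<in> J}"
  have zero: "\<phi> \<zero> = \<zero>"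
    using \<phi>(2)[of \<zero> \<zero>] \<phi>(1)[of \<zero>] by simp
  have "ideal K R"
  proof (rule idealI)
    show "ring R" by (rule ring_axioms)
    show "subgroup K (add_monoid R)"
    proof (rule add.subgroupI)
      show "K \<subseteq> carrier R" by (auto simp: K_def)
      show "K \<noteq> {}"
        using zero by (auto simp: K_def intro!: exI[of _ \<zero>])
      show "\<ominus> a \<in> K" if "a \<in> K" for a
      proof -
        have "s \<otimes> \<ominus> a = (\<ominus> s) \<otimes> a" if "s \<in> carrier R" for s
          using that \<open>a \<in> K\<close> by (simp add: K_def l_minus r_minus)
        then show ?thesis using that by (auto simp: K_def)
      qed
      show "a \<oplus> b \<in> K" if "a \<in> K" "b \<in> K" for a b
        using that by (auto simp: K_def r_distr \<phi>(2))
    qed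
    show "x \<otimes> a \<in> K" if "a \<in> K" "x \<in> carrier R" for a x
      using that by (auto simp: K_def m_assoc[symmetric])
    then show "a \<otimes> x \<in> K" if "a \<in> K" "x \<in> carrier R" for a x
      using that by (metis (no_types, lifting) K_def m_comm mem_Collect_eq)
  qed
  moreover have "x [^] (p ^ e) \<in> K" if "x \<in> J" for x
    using J.Icarr[OF that] that \<phi>(1,3)
    by (auto simp: K_def m_comm[of _ "x [^] (p ^ e)"] intro: J.I_r_closed)
  ultimately have "frobenius_power p R J e \<subseteq> K"
    unfolding frobenius_power_def by (intro genideal_minimal) auto
  then have "y \<in> carrier R" "\<phi> (\<one> \<otimes> y) \<in> J"
    using assms(3) by (auto simp: K_def)
  then show ?thesis by simp
qed

section \<open>Tight closure and the test ideal\<close>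

lemma colon_ideal:
  assumes "ideal I R" "J \<subseteq> carrier R"
  shows "ideal (colon R I J) R"
proof -
  interpret I: ideal I R by fact
  have J: "y \<in> carrier R" if "y \<in> J" for y using that assms(2) by auto
  show ?thesis
  proof (rule idealI)
    show "ring R" by (rule ring_axioms)
    show "subgroup (colon R I J) (add_monoid R)"
      by (rule add.subgroupI)
        (use J in \<open>auto simp: colon_def l_distr l_minus intro!: exI[of _ \<zero>]\<close>)
    show "x \<otimes> a \<in> colon R I J" if "a \<in> colon R I J" "x \<in> carrier R" for a x
      using that J by (auto simp: colon_def m_assoc I.I_l_closed)
    then show "a \<otimes> x \<in> colon R I J" if "a \<in> colon R I J" "x \<in> carrier R" for a x
      using that by (metis (no_types, lifting) colon_def m_comm mem_Collect_eq)
  qed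
qed

lemma test_ideal_ideal: "ideal (test_ideal p R \<aa> t) R"
  unfolding test_ideal_def
proof (rule i_Intersect[of "(\<lambda>J. colon R J (tight_closure p R \<aa> t J)) ` {J. ideal J R}"])
  fix K assume "K \<in> (\<lambda>J. colon R J (tight_closure p R \<aa> t J)) ` {J. ideal J R}"
  then show "ideal K R"
    by (auto intro!: colon_ideal simp: tight_closure_def)
qed (use oneideal in blast)

text \<open>
  The key lemma. The constant \<open>c\<close> that witnesses \<open>z \<in> J\<^sup>*\<close> also witnesses \<open>fz\<^sup>q \<in> (J\<^sup>[\<^sup>q\<^sup>])\<^sup>*\<close>.
\<close>

lemma mult_power_in_tight_closure:
  assumes \<aa>: "ideal \<aa> R" and J: "ideal J R"
    and f: "f \<in> \<aa> [^]\<^bsub>ideals_set R\<^esub> nat \<lceil>t * (real p ^ e - 1)\<rceil>"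
    and z: "z \<in> tight_closure p R \<aa> t J"
  shows "f \<otimes> z [^] (p ^ e) \<in> tight_closure p R \<aa> t (frobenius_power p R J e)"
proof -
  have fR: "f \<in> carrier R" using ideal.Icarr[OF ideal_pow_ideal[OF \<aa>] f] .
  obtain c e\<^sub>0 where zR: "z \<in> carrier R" and c: "c \<in> not_in_minimal_primes R"
    and *: "\<And>e a. e \<ge> e\<^sub>0 \<Longrightarrow> a \<in> \<aa> [^]\<^bsub>ideals_set R\<^esub> nat \<lceil>t * real p ^ e\<rceil> \<Longrightarrow>
      c \<otimes> a \<otimes> z [^] (p ^ e) \<in> frobenius_power p R J e"
    using z unfolding tight_closure_def by blast
  have cR: "c \<in> carrier R" using c by (simp add: not_in_minimal_primes_def)
  have "c \<otimes> a \<otimes> (f \<otimes> z [^] (p ^ e)) [^] (p ^ d) \<in> frobenius_power p R (frobenius_power p R J e) d"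
    if d: "d \<ge> e\<^sub>0" and a: "a \<in> \<aa> [^]\<^bsub>ideals_set R\<^esub> nat \<lceil>t * real p ^ d\<rceil>" for d a
  proof -
    have aR: "a \<in> carrier R" using ideal.Icarr[OF ideal_pow_ideal[OF \<aa>] a] .
    let ?m = "nat \<lceil>t * real p ^ d\<rceil>" and ?n = "nat \<lceil>t * (real p ^ e - 1)\<rceil>"
    have "t * real p ^ (e + d) = t * real p ^ d + real p ^ d * (t * (real p ^ e - 1))"
      by (simp add: power_add algebra_simps)
    also have "\<dots> \<le> real ?m + real p ^ d * real ?n"
      by (intro add_mono mult_left_mono) (auto intro: real_nat_ceiling_ge)
    also have "\<dots> = real (?m + p ^ d * ?n)" by simp
    finally have "nat \<lceil>t * real p ^ (e + d)\<rceil> \<le> ?m + p ^ d * ?n"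
      by (simp only: nat_ceiling_le_eq)
    moreover have "a \<otimes> f [^] (p ^ d) \<in> \<aa> [^]\<^bsub>ideals_set R\<^esub> (?m + p ^ d * ?n)"
      by (intro ideal_pow_mult_closed[OF \<aa> a] power_in_ideal_pow[OF \<aa> f])
    ultimately have "a \<otimes> f [^] (p ^ d) \<in> \<aa> [^]\<^bsub>ideals_set R\<^esub> nat \<lceil>t * real p ^ (e + d)\<rceil>"
      using ideal_pow_antimono[OF \<aa>] by blast
    then have "c \<otimes> (a \<otimes> f [^] (p ^ d)) \<otimes> z [^] (p ^ (e + d)) \<in> frobenius_power p R J (e + d)"
      using d by (intro *) auto
    moreover have "c \<otimes> a \<otimes> (f \<otimes> z [^] (p ^ e)) [^] (p ^ d) =
        c \<otimes> (a \<otimes> f [^] (p ^ d)) \<otimes> z [^] (p ^ (e + d))"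
      using cR aR fR zR by (simp add: nat_pow_distrib nat_pow_pow power_add m_assoc)
    ultimately show ?thesis using frobenius_power_add_subset[OF J] by auto
  qed
  then show ?thesis using c fR zR unfolding tight_closure_def by blast
qed

text \<open>Multiplication by \<open>f\<close> followed by any \<open>R\<close>-linear map \<open>R\<^sup>1\<^sup>/\<^sup>q \<rightarrow> R\<close> preserves the test ideal.\<close>

lemma module_hom_test_ideal:
  assumes \<aa>: "ideal \<aa> R"
    and \<phi>: "\<phi> \<in> module_hom R (root_ring p R e) (self_module R)"
    and f: "f \<in> \<aa> [^]\<^bsub>ideals_set R\<^esub> nat \<lceil>t * (real p ^ e - 1)\<rceil>"
    and x: "x \<in> test_ideal p R \<aa> t"
  shows "\<phi> (x \<otimes> f) \<in> test_ideal p R \<aa> t"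
proof -
  have fR: "f \<in> carrier R" using ideal.Icarr[OF ideal_pow_ideal[OF \<aa>] f] .
  have xR: "x \<in> carrier R" using ideal.Icarr[OF test_ideal_ideal x] .
  have \<phi>R: "\<phi> (x \<otimes> f) \<in> carrier R"
    using \<phi> xR fR by (auto simp: module_hom_root_ring_iff)
  have "\<phi> (x \<otimes> f) \<otimes> z \<in> J" if J: "ideal J R" and z: "z \<in> tight_closure p R \<aa> t J" for J z
  proof -
    have zR: "z \<in> carrier R" using z by (simp add: tight_closure_def)
    have "x \<otimes> (f \<otimes> z [^] (p ^ e)) \<in> frobenius_power p R J e"
      using x mult_power_in_tight_closure[OF \<aa> J f z] frobenius_power_ideal[OF J]
      by (auto simp: test_ideal_def colon_def)
    from module_hom_frobenius_power[OF \<phi> J this]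
    have "\<phi> (x \<otimes> (f \<otimes> z [^] (p ^ e))) \<in> J" .
    moreover have "x \<otimes> (f \<otimes> z [^] (p ^ e)) = z [^] (p ^ e) \<otimes> (x \<otimes> f)"
      using xR fR zR by (simp add: m_ac)
    moreover have "\<phi> (z [^] (p ^ e) \<otimes> (x \<otimes> f)) = z \<otimes> \<phi> (x \<otimes> f)"
      using \<phi> xR fR zR by (simp add: module_hom_root_ring_iff)
    ultimately show ?thesis using \<phi>R zR by (simp add: m_comm)
  qed
  then show ?thesis using \<phi>R by (auto simp: test_ideal_def colon_def)
qed

section \<open>Descent of Frobenius splittings to quotients\<close>

text \<open>A splitting of the Frobenius that preserves an ideal induces one on the quotient.\<close>

lemma F_pure_quotient:
  assumes T: "ideal T R"
    and \<theta>: "\<theta> \<in> module_hom R (root_ring p R 1) (self_module R)"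
    and one: "\<theta> \<one> = \<one>"
    and pres: "\<And>x. x \<in> T \<Longrightarrow> \<theta> x \<in> T"
  shows "F_pure p (R Quot T)"
proof -
  interpret T: ideal T R by fact
  have \<theta>R: "\<And>x. x \<in> carrier R \<Longrightarrow> \<theta> x \<in> carrier R"
    and \<theta>add: "\<And>x y. x \<in> carrier R \<Longrightarrow> y \<in> carrier R \<Longrightarrow> \<theta> (x \<oplus> y) = \<theta> x \<oplus> \<theta> y"
    and \<theta>lin: "\<And>r x. r \<in> carrier R \<Longrightarrow> x \<in> carrier R \<Longrightarrow> \<theta> (r [^] p \<otimes> x) = r \<otimes> \<theta> x"
    using \<theta> unfolding module_hom_root_ring_iff by auto
  have rep: "\<exists>x\<in>carrier R. A = T +> x" if "A \<in> carrier (R Quot T)" for A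
    using that unfolding FactRing_def A_RCOSETS_def' partial_object.simps by blast
  have well: "T +> \<theta> x = T +> \<theta> y" if xy: "x \<in> carrier R" "y \<in> carrier R" "T +> x = T +> y" for x y
  proof -
    have "x \<in> T +> y" using xy T.a_rcos_self by metis
    then obtain u where u: "u \<in> T" "x = u \<oplus> y" by (auto simp: a_r_coset_def')
    then have "\<theta> x = \<theta> u \<oplus> \<theta> y" using xy(2) T.Icarr \<theta>add by blast
    then have "\<theta> x \<in> T +> \<theta> y" using pres[OF u(1)] by (auto simp: a_r_coset_def')
    then show ?thesis using \<theta>R[OF xy(2)] T.a_repr_independence' by metis
  qed
  define g where "g A = T +> \<theta> (SOME x. x \<in> carrier R \<and> A = T +> x)" for A
  have g: "g (T +> x) = T +> \<theta> x" if "x \<in> carrier R" for x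
  proof -
    have "x \<in> carrier R \<and> T +> x = T +> x" using that by blast
    from someI[of "\<lambda>y. y \<in> carrier R \<and> T +> x = T +> y", OF this]
    show ?thesis unfolding g_def by (metis well that)
  qed
  have pow: "(T +> x) [^]\<^bsub>R Quot T\<^esub> p = T +> x [^] p" if "x \<in> carrier R" for x
    using ring_hom_ring.hom_nat_pow[OF T.rcos_ring_hom_ring that] by simp
  note hom_closed = ring_hom_closed[OF T.rcos_ring_hom]
    and hom_add = ring_hom_add[OF T.rcos_ring_hom] and hom_mult = ring_hom_mult[OF T.rcos_ring_hom]
  have "g \<in> module_hom (R Quot T) (root_ring p (R Quot T) 1) (self_module (R Quot T))"
    unfolding module_hom_root_ring_iff
  proof (intro conjI ballI Pi_I)
    fix A assume "A \<in> carrier (R Quot T)"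
    then obtain x where x: "x \<in> carrier R" "A = T +> x" using rep by blast
    show "g A \<in> carrier (R Quot T)"
      unfolding x(2) g[OF x(1)] by (rule hom_closed[OF \<theta>R[OF x(1)]])
    fix B assume "B \<in> carrier (R Quot T)"
    then obtain y where y: "y \<in> carrier R" "B = T +> y" using rep by blast
    show "g (A \<oplus>\<^bsub>R Quot T\<^esub> B) = g A \<oplus>\<^bsub>R Quot T\<^esub> g B"
      using x y \<theta>R by (simp only: g \<theta>add hom_add[symmetric] a_closed)
    show "g (A [^]\<^bsub>R Quot T\<^esub> (p ^ 1) \<otimes>\<^bsub>R Quot T\<^esub> B) = A \<otimes>\<^bsub>R Quot T\<^esub> g B"
      using x y \<theta>R
      by (simp only: g \<theta>lin pow hom_mult[symmetric] nat_pow_closed m_closed power_one_right)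
  qed
  moreover have "g (A [^]\<^bsub>R Quot T\<^esub> p) = A" if "A \<in> carrier (R Quot T)" for A
  proof -
    from rep[OF that] obtain x where x: "x \<in> carrier R" "A = T +> x" by blast
    have "\<theta> (x [^] p) = x" using \<theta>lin[of x \<one>] x(1) one by simp
    then show ?thesis using g[of "x [^] p"] x by (simp only: pow nat_pow_closed)
  qed
  ultimately show ?thesis
    unfolding F_pure_def splits_def by (auto simp: self_module_def)
qed

end

theorem corollary4p3:
  fixes p :: nat and t :: real
    and S :: "('b, 'n) ring_scheme" and I :: "'b set"
    and R :: "('a, 'm) ring_scheme" and \<aa> :: "'a set"
  assumes "char_p_ring p S" and "regular_ring S" and "F_finite p S"
    and "ideal I S" and "S Quot I \<simeq> R"
    and "char_p_ring p R" and "noetherian_ring R" and "reduced_ring R"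
    and "ideal \<aa> R" and "\<aa> \<inter> not_in_minimal_primes R \<noteq> {}"
    and "t > 0" and "sharply_F_pure p R \<aa> t"
  shows "F_pure p (R Quot test_ideal p R \<aa> t)"
proof -
  interpret cring R using \<open>char_p_ring p R\<close> by (simp add: char_p_ring_def)
  have p: "p > 0" using \<open>char_p_ring p R\<close> by (simp add: char_p_ring_def prime_gt_0_nat)
  let ?T = "test_ideal p R \<aa> t"
  let ?E = "{e. \<exists>f \<in> \<aa> [^]\<^bsub>ideals_set R\<^esub> nat \<lceil>t * (real p ^ e - 1)\<rceil>.
       splits R (self_module R) (root_ring p R e) (root_map p R e f)}"
  \<comment> \<open>The case \<open>e = 0\<close> carries no information; infinitely many exponents provide one with \<open>e \<ge> 1\<close>.\<close>
  have "infinite ?E" using \<open>sharply_F_pure p R \<aa> t\<close> by (simp add: sharply_F_pure_def)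
  then obtain e where "e > 0" "e \<in> ?E" by (meson infinite_nat_iff_unbounded)
  then obtain d f \<phi> where e: "e = Suc d"
    and f: "f \<in> \<aa> [^]\<^bsub>ideals_set R\<^esub> nat \<lceil>t * (real p ^ e - 1)\<rceil>"
    and \<phi>: "\<phi> \<in> module_hom R (root_ring p R e) (self_module R)"
    and inv: "\<forall>x\<in>carrier (self_module R). \<phi> (root_map p R e f x) = x"
    by (auto simp: splits_def gr0_conv_Suc)
  have fR: "f \<in> carrier R" using ideal.Icarr[OF ideal_pow_ideal[OF \<open>ideal \<aa> R\<close>] f] .
  have \<phi>R: "\<And>x. x \<in> carrier R \<Longrightarrow> \<phi> x \<in> carrier R"
    and \<phi>add: "\<And>x y. x \<in> carrier R \<Longrightarrow> y \<in> carrier R \<Longrightarrow> \<phi> (x \<oplus>\<^bsub>R\<^esub> y) = \<phi> x \<oplus>\<^bsub>R\<^esub> \<phi> y"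
    and \<phi>lin: "\<And>r x. r \<in> carrier R \<Longrightarrow> x \<in> carrier R \<Longrightarrow> \<phi> (r [^]\<^bsub>R\<^esub> (p ^ e) \<otimes>\<^bsub>R\<^esub> x) = r \<otimes>\<^bsub>R\<^esub> \<phi> x"
    using \<phi> unfolding module_hom_root_ring_iff by auto
  \<comment> \<open>Precomposing with the \<open>p\<^sup>d\<close>-th power, \<open>d = e - 1\<close>, gives a map that takes out
    \<open>p\<close>-th powers instead of \<open>p\<^sup>e\<close>-th powers; it is additive because \<open>R\<close> has characteristic \<open>p\<close>.\<close>
  define \<theta> where "\<theta> x = \<phi> (x [^]\<^bsub>R\<^esub> (p ^ d) \<otimes>\<^bsub>R\<^esub> f)" for x
  have "\<theta> \<in> module_hom R (root_ring p R 1) (self_module R)"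
    unfolding module_hom_root_ring_iff
  proof (intro conjI ballI Pi_I)
    fix x assume x: "x \<in> carrier R"
    then show "\<theta> x \<in> carrier R" using fR by (simp add: \<theta>_def \<phi>R)
    fix y assume y: "y \<in> carrier R"
    show "\<theta> (x \<oplus>\<^bsub>R\<^esub> y) = \<theta> x \<oplus>\<^bsub>R\<^esub> \<theta> y"
      using x y fR by (simp add: \<theta>_def char_p_ring_add_pow[OF \<open>char_p_ring p R\<close>] l_distr \<phi>add)
    have "(x [^]\<^bsub>R\<^esub> (p ^ 1) \<otimes>\<^bsub>R\<^esub> y) [^]\<^bsub>R\<^esub> (p ^ d) \<otimes>\<^bsub>R\<^esub> f =
        x [^]\<^bsub>R\<^esub> (p ^ e) \<otimes>\<^bsub>R\<^esub> (y [^]\<^bsub>R\<^esub> (p ^ d) \<otimes>\<^bsub>R\<^esub> f)"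
      using x y fR by (simp add: e nat_pow_distrib nat_pow_pow m_assoc)
    then show "\<theta> (x [^]\<^bsub>R\<^esub> (p ^ 1) \<otimes>\<^bsub>R\<^esub> y) = x \<otimes>\<^bsub>R\<^esub> \<theta> y"
      using x y fR by (simp add: \<theta>_def \<phi>lin)
  qed
  moreover have "\<theta> \<one>\<^bsub>R\<^esub> = \<one>\<^bsub>R\<^esub>"
    using inv fR by (simp add: \<theta>_def root_map_def frobenius_algebra_def self_module_def)
      (metis l_one nat_pow_one one_closed)
  moreover have "\<theta> x \<in> ?T" if x: "x \<in> ?T" for x
  proof -
    interpret T: ideal ?T R by (rule test_ideal_ideal)
    obtain k where k: "p ^ d = Suc k" using p by (metis gr0_conv_Suc zero_less_power)
    have "x [^]\<^bsub>R\<^esub> (p ^ d) \<in> ?T"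
      unfolding k using x T.Icarr[OF x] by (simp add: T.I_l_closed)
    then show ?thesis
      unfolding \<theta>_def by (rule module_hom_test_ideal[OF \<open>ideal \<aa> R\<close> \<phi> f])
  qed
  ultimately show ?thesis by (intro F_pure_quotient test_ideal_ideal)
qed

end
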